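(* Let $r,s,l$ be nonnegative integers and let $m$ be a positive integer. Assume that all denominators occurring below are nonzero and that all series in the identity under consideration converge. If $m$ is odd, then $$\sum_{k=1}^\infty \frac{1}{w_{rk+l}\,w_{r(k+1)+l}\,w_{mk+s}\,w_{m(k+1)+s}} = \frac{1}{u_m w_{m+s}}\sum_{k=1}^\infty (-1)^{k-1} \frac{\bigl(w_{rk+l}+w_{r(k+2)+l}\bigr)u_{mk}}{w_{rk+l}\, w_{r(k+1)+l}\, w_{r(k+2)+l}\, w_{m(k+1)+s}}.$$ If $m$ is even, then $$\sum_{k=1}^\infty \frac{(-1)^k}{w_{rk+l}\,w_{r(k+1)+l}\,w_{mk+s}\,w_{m(k+1)+s}} = \frac{1}{u_m w_{m+s}}\sum_{k=1}^\infty (-1)^k \frac{\bigl(w_{rk+l}+w_{r(k+2)+l}\bigr)u_{mk}}{w_{rk+l}\, w_{r(k+1)+l}\, w_{r(k+2)+l}\, w_{m(k+1)+s}}.$$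
   Context: Let $a,b,p$ be complex numbers. The sequence $(w_n)_{n\ge 0}$ is defined by $w_0=a$, $w_1=b$, $w_n=p\,w_{n-1}+w_{n-2}$ for $n\ge 2$. The sequence $(u_n)_{n\ge0}$ is defined by $u_0=0$, $u_1=1$, $u_n=p\,u_{n-1}+u_{n-2}$ for $n\ge 2$. *)

theory Defs
  imports Complex_Main
begin

abbreviation suminf_from_1 :: "(nat \<Rightarrow> complex) \<Rightarrow> complex" where
  "suminf_from_1 f \<equiv> (\<Sum>k. f (Suc k))"

abbreviation summable_from_1 :: "(nat \<Rightarrow> complex) \<Rightarrow> bool" where
  "summable_from_1 f \<equiv> summable (\<lambda>k. f (Suc k))"

end

theory Submission imports Defs begin

text \<open>
  Write \<open>A k = w (r * k + l)\<close>, \<open>B k = w (m * k + s)\<close>, \<open>D = u m * w (m + s)\<close> and put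
  \<open>d k = (-1) ^ k / (A k * A (k + 1))\<close>, \<open>c k = u (m * k) / B (k + 1)\<close>. The cross difference
  \<open>u (n + m) * w (n + t) - u n * w (n + m + t) = (-1) ^ n * u m * w t\<close> (a form of d'Ocagne's
  identity, lemma \<open>fib_like_cross_difference\<close>) says that \<open>D / (B k * B (k + 1))\<close> is, up to sign,
  the difference \<open>c k - c (k - 1)\<close>. So the terms on the left are \<open>d k * (c k - c (k - 1)) / D\<close>,
  those on the right are \<open>(d k - d (k + 1)) * c k / D\<close> (both up to one global sign), and the
  identity is summation by parts. All that remains is the boundary term
  \<open>d (n + 1) * c n\<close>, which converges to some \<open>L\<close> as both series converge.

  The delicate point is \<open>L = 0\<close>: convergence alone does not give it for general \<open>c\<close> and \<open>d\<close>.
  As the terms of the first series tend to \<open>0\<close>, the sequence \<open>d n * c n\<close> has limit \<open>L\<close> too. If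
  \<open>L \<noteq> 0\<close>, the quotient \<open>d (n + 1) / d n = - A n / A (n + 2)\<close> tends to \<open>1\<close>, so
  \<open>A (n + 2) / A n\<close> tends to \<open>-1\<close>. Let \<open>\<alpha>\<close>, \<open>\<beta>\<close> be the roots of \<open>x^2 = p * x + 1\<close>. The
  subsequence \<open>A\<close> satisfies a recurrence with characteristic roots \<open>\<alpha> ^ r\<close> and \<open>\<beta> ^ r\<close>, and a limit
  ratio \<open>-1\<close> forces the squares of both to be \<open>-1\<close>
  (lemma \<open>alternating_ratio_roots_of_unity\<close>). In particular \<open>\<alpha> ^ (4 * r) = \<beta> ^ (4 * r) = 1\<close>.
  If \<open>\<alpha> \<noteq> \<beta>\<close>, Binet's formula gives \<open>u n = 0\<close> whenever \<open>4 * r\<close> divides \<open>n\<close>, so the boundary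
  term vanishes infinitely often and \<open>L = 0\<close> after all. If \<open>\<alpha> = \<beta>\<close>, then \<open>w n\<close> and \<open>u n\<close> are
  affine functions of \<open>n\<close> times a number of modulus \<open>1\<close>, and a growth estimate of the boundary
  term gives \<open>L = 0\<close> directly (lemma \<open>boundary_limit_zero_double_root\<close>).
\<close>

section \<open>Second-order recurrences with characteristic polynomial x^2 - p x - 1\<close>

definition fib_like :: "complex \<Rightarrow> (nat \<Rightarrow> complex) \<Rightarrow> bool" where
  "fib_like p w \<longleftrightarrow> (\<forall>n. w (n + 2) = p * w (n + 1) + w n)"

lemma fib_like_rec: "fib_like p w \<Longrightarrow> w (Suc (Suc n)) = p * w (Suc n) + w n"
  by (simp add: fib_like_def)

text \<open>
  A solution is determined by its two initial values. This is how closed forms and identities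
  are proved below: check that both sides solve the recurrence and agree at \<open>0\<close> and \<open>1\<close>.
\<close>

lemma fib_like_unique:
  assumes "fib_like p v" "fib_like p w" "v 0 = w 0" "v 1 = w 1"
  shows "v n = w n"
proof -
  have "v n = w n \<and> v (Suc n) = w (Suc n)"
  proof (induction n)
    case 0
    then show ?case using assms by simp
  next
    case (Suc n)
    then show ?case by (simp add: fib_like_rec[OF assms(1)] fib_like_rec[OF assms(2)])
  qed
  then show ?thesis by simp
qed

lemma characteristic_roots:
  obtains \<alpha> \<beta> :: complex where "\<alpha> + \<beta> = p" "\<alpha> * \<beta> = -1"
proof
  let ?q = "csqrt (p\<^sup>2 + 4)"
  show "(p + ?q) / 2 + (p - ?q) / 2 = p"
    by (simp add: field_simps)
  have "(p + ?q) * (p - ?q) = p\<^sup>2 - ?q\<^sup>2"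
    by (simp add: algebra_simps power2_eq_square)
  then show "(p + ?q) / 2 * ((p - ?q) / 2) = -1"
    by (simp add: power2_csqrt)
qed

lemma fib_like_char_power:
  fixes x p :: complex
  assumes "x\<^sup>2 = p * x + 1"
  shows "x ^ (n + 2) = p * x ^ (n + 1) + x ^ n"
proof -
  have "x ^ (n + 2) = x ^ n * x\<^sup>2" by (rule power_add)
  then show ?thesis by (simp add: assms algebra_simps)
qed

text \<open>
  Binet's formula, multiplied out by \<open>\<alpha> - \<beta>\<close>, so that comparing the two sides as solutions of
  the recurrence involves no division.
\<close>

lemma binet:
  assumes w: "fib_like p w" and sum: "\<alpha> + \<beta> = p" and prod: "\<alpha> * \<beta> = -1"
  shows "(\<alpha> - \<beta>) * w n = (w 1 - \<beta> * w 0) * \<alpha> ^ n - (w 1 - \<alpha> * w 0) * \<beta> ^ n"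
proof -
  let ?v = "\<lambda>n. (w 1 - \<beta> * w 0) * \<alpha> ^ n - (w 1 - \<alpha> * w 0) * \<beta> ^ n"
  have chars: "\<alpha>\<^sup>2 = p * \<alpha> + 1" "\<beta>\<^sup>2 = p * \<beta> + 1"
    using prod unfolding sum[symmetric] by (auto simp: power2_eq_square algebra_simps)
  have "fib_like p ?v"
    unfolding fib_like_def fib_like_char_power[OF chars(1)] fib_like_char_power[OF chars(2)]
    by (simp add: algebra_simps)
  moreover have "fib_like p (\<lambda>n. (\<alpha> - \<beta>) * w n)"
    unfolding fib_like_def by (simp add: fib_like_rec[OF w] algebra_simps)
  ultimately show ?thesis
    using fib_like_unique[of p "\<lambda>n. (\<alpha> - \<beta>) * w n" ?v n] by (simp add: algebra_simps)
qed

text \<open>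
  At a double root the powers \<open>\<alpha> ^ n\<close> come with an affine factor in \<open>n\<close>. Its slope is fixed by
  \<open>w 1\<close>, and \<open>- \<alpha>\<close> stands for the inverse of \<open>\<alpha>\<close>, as \<open>\<alpha>\<close> is a square root of \<open>-1\<close>.
\<close>

lemma binet_double:
  assumes w: "fib_like p w" and sum: "\<alpha> + \<alpha> = p" and sq: "\<alpha> * \<alpha> = -1"
  shows "w n = (w 0 + of_nat n * (- \<alpha> * w 1 - w 0)) * \<alpha> ^ n"
proof -
  define y where "y = - \<alpha> * w 1 - w 0"
  let ?v = "\<lambda>n. (w 0 + of_nat n * y) * \<alpha> ^ n"
  have "fib_like p ?v"
    unfolding fib_like_def
  proof
    fix n
    have 1: "\<alpha> ^ (n + 2) = - (\<alpha> ^ n)" by (simp add: sq flip: mult.assoc)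
    have "p * ((w 0 + of_nat (n + 1) * y) * \<alpha> ^ (n + 1))
        = 2 * (\<alpha> * \<alpha>) * (w 0 + of_nat (n + 1) * y) * \<alpha> ^ n"
      by (simp add: algebra_simps flip: sum)
    also have "\<dots> = - 2 * (w 0 + of_nat (n + 1) * y) * \<alpha> ^ n"
      by (simp add: sq)
    finally have 2: "p * ((w 0 + of_nat (n + 1) * y) * \<alpha> ^ (n + 1))
        = - 2 * (w 0 + of_nat (n + 1) * y) * \<alpha> ^ n" .
    show "(w 0 + of_nat (n + 2) * y) * \<alpha> ^ (n + 2)
      = p * ((w 0 + of_nat (n + 1) * y) * \<alpha> ^ (n + 1)) + (w 0 + of_nat n * y) * \<alpha> ^ n"
      unfolding 1 2 by (simp add: algebra_simps)
  qed
  moreover have "?v 1 = w 1"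
  proof -
    have "?v 1 = - (\<alpha> * \<alpha>) * w 1" by (simp add: y_def algebra_simps)
    then show ?thesis by (simp add: sq)
  qed
  ultimately show ?thesis
    using fib_like_unique[OF w, of ?v n] by (simp add: y_def)
qed

text \<open>
  Along an arithmetic progression of step \<open>r\<close> the roots \<open>\<alpha>\<close>, \<open>\<beta>\<close> are replaced by
  \<open>\<alpha> ^ r\<close>, \<open>\<beta> ^ r\<close>. Distinct roots let the common factor \<open>\<alpha> - \<beta>\<close> of Binet's formula cancel.
\<close>

lemma subsampled_recurrence:
  assumes w: "fib_like p w" and sum: "\<alpha> + \<beta> = p" and prod: "\<alpha> * \<beta> = -1"
    and ne: "\<alpha> \<noteq> \<beta>"
  shows "w (n + 2 * r) = (\<alpha> ^ r + \<beta> ^ r) * w (n + r) - \<alpha> ^ r * \<beta> ^ r * w n"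
proof -
  note b = binet[OF w sum prod]
  have "(\<alpha> - \<beta>) * w (n + 2 * r)
      = (\<alpha> ^ r + \<beta> ^ r) * ((\<alpha> - \<beta>) * w (n + r)) - \<alpha> ^ r * \<beta> ^ r * ((\<alpha> - \<beta>) * w n)"
    unfolding b mult_2 by (simp add: power_add algebra_simps)
  then have "(\<alpha> - \<beta>) * w (n + 2 * r)
      = (\<alpha> - \<beta>) * ((\<alpha> ^ r + \<beta> ^ r) * w (n + r) - \<alpha> ^ r * \<beta> ^ r * w n)"
    by (simp add: algebra_simps)
  then show ?thesis using ne by simp
qed

text \<open>
  A Casoratian: the recurrence step has determinant \<open>-1\<close>, so this two-by-two determinant changes
  sign when \<open>n\<close> grows by one.
\<close>

lemma fib_like_cross_difference_1:
  assumes w: "fib_like p w" and u: "fib_like p u" and u0: "u 0 = 0" and u1: "u 1 = 1"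
  shows "u (Suc n) * w (n + t) - u n * w (Suc (n + t)) = (-1) ^ n * w t"
proof (induction n)
  case 0
  then show ?case using u0 u1 by simp
next
  case (Suc n)
  have "u (Suc (Suc n)) * w (Suc n + t) - u (Suc n) * w (Suc (Suc n + t))
      = - (u (Suc n) * w (n + t) - u n * w (Suc (n + t)))"
    by (simp add: fib_like_rec[OF w] fib_like_rec[OF u] algebra_simps)
  then show ?case using Suc by simp
qed

text \<open>
  For fixed \<open>n\<close> and \<open>t\<close> both sides solve the recurrence in \<open>m\<close>, so only \<open>m = 0\<close> and \<open>m = 1\<close> need
  to be compared. Applied with \<open>n = m * k\<close> and \<open>t = m + s\<close>, this turns the reciprocals of
  \<open>w (n + t) * w (n + m + t)\<close> into telescoping differences.
\<close>

lemma fib_like_cross_difference: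
  assumes w: "fib_like p w" and u: "fib_like p u" and u0: "u 0 = 0" and u1: "u 1 = 1"
  shows "u (n + m) * w (n + t) - u n * w (n + m + t) = (-1) ^ n * u m * w t"
proof -
  let ?f = "\<lambda>m. u (n + m) * w (n + t) - u n * w (n + m + t)"
  have "fib_like p ?f"
    unfolding fib_like_def
    by (simp add: fib_like_rec[OF w] fib_like_rec[OF u] algebra_simps)
  moreover have "fib_like p (\<lambda>m. (-1) ^ n * u m * w t)"
    unfolding fib_like_def by (simp add: fib_like_rec[OF u] algebra_simps)
  moreover have "?f 1 = (-1) ^ n * u 1 * w t"
    using fib_like_cross_difference_1[OF assms, of n t] u1 by simp
  ultimately show ?thesis
    using fib_like_unique[of p ?f "\<lambda>m. (-1) ^ n * u m * w t" m] u0 by simp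
qed

section \<open>Summation by parts\<close>

text \<open>
  The partial sums differ by exactly the boundary term \<open>d (n + 1) * c n\<close>, so it converges when both
  series do. The second form \<open>d n * c n\<close> of the limit comes from the vanishing of the terms of the
  first series; comparing the two forms gives access to the ratio of consecutive \<open>d n\<close>.
\<close>

lemma summation_by_parts_limit:
  fixes c d :: "nat \<Rightarrow> complex"
  assumes c0: "c 0 = 0"
    and F: "summable (\<lambda>k. d (Suc k) * (c (Suc k) - c k))"
    and G: "summable (\<lambda>k. (d (Suc k) - d (Suc (Suc k))) * c (Suc k))"
  obtains L where
    "(\<Sum>k. d (Suc k) * (c (Suc k) - c k))
       = (\<Sum>k. (d (Suc k) - d (Suc (Suc k))) * c (Suc k)) + L"
    "(\<lambda>n. d (Suc n) * c n) \<longlonglongrightarrow> L"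
    "(\<lambda>n. d n * c n) \<longlonglongrightarrow> L"
proof
  let ?F = "\<lambda>k. d (Suc k) * (c (Suc k) - c k)"
  let ?G = "\<lambda>k. (d (Suc k) - d (Suc (Suc k))) * c (Suc k)"
  define L where "L = suminf ?F - suminf ?G"
  show "suminf ?F = suminf ?G + L" by (simp add: L_def)
  have eq: "(\<Sum>k<n. ?F k) - (\<Sum>k<n. ?G k) = d (Suc n) * c n" for n
    by (induction n) (simp_all add: c0 algebra_simps)
  have "(\<lambda>n. (\<Sum>k<n. ?F k) - (\<Sum>k<n. ?G k)) \<longlonglongrightarrow> L"
    unfolding L_def by (intro tendsto_diff summable_LIMSEQ F G)
  then show 1: "(\<lambda>n. d (Suc n) * c n) \<longlonglongrightarrow> L"
    by (simp only: eq)
  have "(\<lambda>n. ?F n + d (Suc n) * c n) \<longlonglongrightarrow> 0 + L"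
    by (intro tendsto_add summable_LIMSEQ_zero F 1)
  then have "(\<lambda>n. d (Suc n) * c (Suc n)) \<longlonglongrightarrow> L"
    by (simp add: algebra_simps)
  then show "(\<lambda>n. d n * c n) \<longlonglongrightarrow> L"
    by (rule LIMSEQ_imp_Suc)
qed

section \<open>Vanishing of the boundary term\<close>

text \<open>
  Let \<open>q k\<close> be the ratio of consecutive terms. Dividing the recurrence by \<open>A k\<close> shows that
  \<open>(x + y) * q k\<close> tends to \<open>x * y - 1\<close>, while \<open>q (k + 1) * q k\<close> tends to \<open>-1\<close>. Computing the
  limit of \<open>(x + y)^2 * q (k + 1) * q k\<close> in both ways gives \<open>(x + y)^2 + (x * y - 1)^2 = 0\<close>,
  and the left side factors as \<open>(x^2 + 1) * (y^2 + 1)\<close>.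
\<close>

lemma alternating_ratio_roots_of_unity:
  fixes A :: "nat \<Rightarrow> complex"
  assumes rec: "\<And>k. A (Suc (Suc k)) = (x + y) * A (Suc k) - x * y * A k"
    and xy: "(x * y)\<^sup>2 = 1"
    and nz: "\<And>k. A (Suc k) \<noteq> 0"
    and lim: "(\<lambda>k. A (Suc (Suc k)) / A k) \<longlonglongrightarrow> -1"
  shows "x\<^sup>2 = -1" "y\<^sup>2 = -1"
proof -
  define q where "q k = A (Suc (Suc k)) / A (Suc k)" for k
  have lim': "(\<lambda>k. A (Suc (Suc (Suc k))) / A (Suc k)) \<longlonglongrightarrow> -1"
    using lim by (rule LIMSEQ_Suc)
  have q1: "(x + y) * q k = A (Suc (Suc (Suc k))) / A (Suc k) + x * y" for k
    using nz[of k] by (simp add: q_def rec[of "Suc k"] field_simps)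
  have q2: "q (Suc k) * q k = A (Suc (Suc (Suc k))) / A (Suc k)" for k
    using nz[of "Suc k"] by (simp add: q_def field_simps)
  have l1: "(\<lambda>k. (x + y) * q k) \<longlonglongrightarrow> -1 + x * y"
    unfolding q1 by (intro tendsto_add lim' tendsto_const)
  have "(\<lambda>k. ((x + y) * q (Suc k)) * ((x + y) * q k)) \<longlonglongrightarrow> (-1 + x * y) * (-1 + x * y)"
    by (intro tendsto_mult l1 LIMSEQ_Suc[OF l1])
  moreover have "(\<lambda>k. (x + y)\<^sup>2 * (q (Suc k) * q k)) \<longlonglongrightarrow> (x + y)\<^sup>2 * (-1)"
    unfolding q2 by (intro tendsto_mult lim' tendsto_const)
  moreover have "(\<lambda>k. (x + y)\<^sup>2 * (q (Suc k) * q k))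
      = (\<lambda>k. ((x + y) * q (Suc k)) * ((x + y) * q k))"
    by (simp add: power2_eq_square mult_ac)
  ultimately have "(-1 + x * y) * (-1 + x * y) = (x + y)\<^sup>2 * (-1)"
    using LIMSEQ_unique by metis
  then have "(x\<^sup>2 + 1) * (y\<^sup>2 + 1) = 0"
    by algebra
  then have "x\<^sup>2 = -1 \<or> y\<^sup>2 = -1"
    by (simp add: add_eq_0_iff2)
  moreover have "x\<^sup>2 * y\<^sup>2 = 1"
    using xy by (simp add: power_mult_distrib)
  ultimately show "x\<^sup>2 = -1" "y\<^sup>2 = -1"
    by (metis minus_minus mult_minus1 mult_minus1_right)+
qed

lemma affine_nat_at_infinity:
  fixes x y :: complex
  assumes "y \<noteq> 0" "r > 0"
  shows "filterlim (\<lambda>k. x + of_nat (r * k + l) * y) at_infinity sequentially"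
proof -
  have "strict_mono (\<lambda>k. r * k + l)"
    using assms by (simp add: strict_mono_def)
  then have "filterlim (\<lambda>k. r * k + l) sequentially sequentially"
    by (rule filterlim_subseq)
  then have "filterlim (\<lambda>k. of_nat (r * k + l) :: complex) at_infinity sequentially"
    by (rule filterlim_compose[OF tendsto_of_nat])
  then have "filterlim (\<lambda>k. of_nat (r * k + l) * y) at_infinity sequentially"
    using tendsto_mult_filterlim_at_infinity[OF tendsto_const assms(1)] by (simp only: mult.commute)
  then show ?thesis
    by (rule tendsto_add_filterlim_at_infinity[OF tendsto_const])
qed

text \<open>
  With a double root \<open>\<alpha>\<close>, which has modulus \<open>1\<close>, the modulus of \<open>u n\<close> is \<open>n\<close> and that of \<open>w n\<close> is
  \<open>norm (x + n * y)\<close> for constants \<open>x\<close>, \<open>y\<close>. If \<open>y = 0\<close>, then \<open>w\<close> has constant nonzero modulus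
  and the boundary term grows linearly, so it cannot converge. If \<open>y \<noteq> 0\<close>, the modulus of the
  quotient of \<open>u\<close> and \<open>w\<close> tends to \<open>1 / norm y\<close>, and the remaining two reciprocals tend to \<open>0\<close>, since the step \<open>r\<close> is positive.
\<close>

lemma boundary_limit_zero_double_root:
  fixes w u :: "nat \<Rightarrow> complex"
  assumes w: "fib_like p w" and u: "fib_like p u" and u0: "u 0 = 0" and u1: "u 1 = 1"
    and m: "m > 0" and r: "r > 0"
    and sum: "\<alpha> + \<alpha> = p" and sq: "\<alpha> * \<alpha> = -1"
    and nzA: "\<And>k. k \<ge> 1 \<Longrightarrow> w (r * k + l) \<noteq> 0"
    and lim: "(\<lambda>k. (-1) ^ k / (w (r * k + l) * w (r * (k + 1) + l))
                 * (u (m * k) / w (m * (k + 1) + s))) \<longlonglongrightarrow> L"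
  shows "L = 0"
proof -
  define x where "x = w 0"
  define y where "y = - \<alpha> * w 1 - w 0"
  have norm_\<alpha>: "norm \<alpha> = 1"
  proof -
    have "norm \<alpha> * norm \<alpha> = 1" by (simp flip: norm_mult add: sq)
    then show ?thesis
      by (simp flip: power2_eq_square add: power2_eq_1_iff) (smt (verit) norm_ge_zero)
  qed
  have w_eq: "norm (w n) = norm (x + of_nat n * y)" for n
    unfolding binet_double[OF w sum sq, of n] x_def y_def
    by (simp add: norm_mult norm_power norm_\<alpha>)
  have u_eq: "norm (u n) = real n" for n
    unfolding binet_double[OF u sum sq, of n]
    by (simp add: norm_mult norm_power norm_\<alpha> u0 u1[simplified])
  let ?P = "\<lambda>k. norm (x + of_nat (r * k + l) * y)"
  let ?Q = "\<lambda>k. norm (x + of_nat (m * (k + 1) + s) * y)"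
  have nlim: "(\<lambda>k. 1 / ?P k * (1 / ?P (k + 1)) * (real (m * k) / ?Q k)) \<longlonglongrightarrow> norm L"
    using tendsto_norm[OF lim]
    by (simp add: norm_mult norm_divide norm_power w_eq u_eq)
  show ?thesis
  proof (cases "y = 0")
    case True
    have "x \<noteq> 0" using nzA[of 1] w_eq[of "r * 1 + l"] True by auto
    have "(\<lambda>k. norm x ^ 3 / real m * (real (m * k) / norm x ^ 3)) \<longlonglongrightarrow> norm x ^ 3 / real m * norm L"
      using nlim True by (intro tendsto_mult tendsto_const) (simp add: power3_eq_cube)
    then have "(\<lambda>k. real k) \<longlonglongrightarrow> norm x ^ 3 / real m * norm L"
      using \<open>x \<noteq> 0\<close> m by (simp add: field_simps)
    then have False
      using filterlim_real_sequentially not_tendsto_and_filterlim_at_infinity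
      by (metis filterlim_at_top_imp_at_infinity sequentially_bot)
    then show ?thesis ..
  next
    case False
    have P0: "(\<lambda>k. 1 / ?P k) \<longlonglongrightarrow> 0"
      using tendsto_norm_zero[OF tendsto_divide_0[OF tendsto_const[of "1::complex"]
            affine_nat_at_infinity[OF False r, of x l]]]
      by (simp add: norm_divide)
    have P1: "(\<lambda>k. 1 / ?P (k + 1)) \<longlonglongrightarrow> 0"
      using LIMSEQ_Suc[OF P0] by simp
    have Q: "(\<lambda>k. real (m * k) / ?Q k) \<longlonglongrightarrow> norm (1 / y)"
    proof -
      \<comment> \<open>The denominator is \<open>e = m * k * y + z\<close>, so the quotient is \<open>(1 - z / e) / y\<close>.\<close>
      define z where "z = x + of_nat (m + s) * y"
      have inv: "(\<lambda>k. 1 / (x + of_nat (m * k + (m + s)) * y)) \<longlonglongrightarrow> 0"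
        using tendsto_divide_0[OF tendsto_const affine_nat_at_infinity[OF False m]] .
      have ev: "\<forall>\<^sub>F k in sequentially. x + of_nat (m * k + (m + s)) * y \<noteq> 0"
        using affine_nat_at_infinity[OF False m] filterlim_at_infinity_imp_eventually_ne by blast
      have "(\<lambda>k. 1 / y * (1 - z * (1 / (x + of_nat (m * k + (m + s)) * y))))
              \<longlonglongrightarrow> 1 / y * (1 - z * 0)"
        by (intro tendsto_mult tendsto_diff tendsto_const inv)
      moreover have "\<forall>\<^sub>F k in sequentially.
          1 / y * (1 - z * (1 / (x + of_nat (m * k + (m + s)) * y)))
          = of_nat (m * k) / (x + of_nat (m * k + (m + s)) * y)"
        using ev
      proof eventually_elim
        case (elim k)
        let ?e = "x + of_nat (m * k + (m + s)) * y"
        have e: "?e - z = of_nat (m * k) * y" by (simp add: z_def algebra_simps)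
        have "1 / y * (1 - z * (1 / ?e)) = (?e - z) / (y * ?e)"
          using elim False by (simp add: divide_simps)
        also have "\<dots> = of_nat (m * k) / ?e"
          unfolding e using False by simp
        finally show ?case .
      qed
      ultimately have "(\<lambda>k. of_nat (m * k) / (x + of_nat (m * k + (m + s)) * y)) \<longlonglongrightarrow> 1 / y"
        using Lim_transform_eventually by fastforce
      from tendsto_norm[OF this] show ?thesis
        by (simp add: norm_divide norm_mult algebra_simps)
    qed
    have "(\<lambda>k. 1 / ?P k * (1 / ?P (k + 1)) * (real (m * k) / ?Q k)) \<longlonglongrightarrow> 0 * 0 * norm (1 / y)"
      by (intro tendsto_mult P0 P1 Q)
    from LIMSEQ_unique[OF this nlim] show ?thesis by simp
  qed
qed

text \<open>
  A nonzero limit would make \<open>A (k + 2) / A k\<close> tend to \<open>-1\<close>, and then \<open>\<alpha>\<close> and \<open>\<beta>\<close> are roots of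
  unity. This degenerate case does occur (\<open>p^2 = -2\<close> and \<open>r = 2\<close> give \<open>A (k + 2) = - A k\<close>), so
  the ratio alone gives no contradiction: one comes from the zeros of \<open>u\<close> if the roots are distinct,
  and from growth if they coincide.
\<close>

lemma boundary_limit_zero:
  fixes w u :: "nat \<Rightarrow> complex"
  assumes w: "fib_like p w" and u: "fib_like p u" and u0: "u 0 = 0" and u1: "u 1 = 1"
    and m: "m > 0"
    and nzA: "\<And>k. k \<ge> 1 \<Longrightarrow> w (r * k + l) \<noteq> 0"
    and d: "\<And>k. d k = (-1) ^ k / (w (r * k + l) * w (r * (k + 1) + l))"
    and c: "\<And>k. c k = u (m * k) / w (m * (k + 1) + s)"
    and lim: "(\<lambda>k. d k * c k) \<longlonglongrightarrow> L"
    and lim': "(\<lambda>k. d (Suc k) * c k) \<longlonglongrightarrow> L"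
  shows "L = 0"
proof (rule ccontr)
  assume L: "L \<noteq> 0"
  define A where "A k = w (r * k + l)" for k
  have nz: "A (Suc k) \<noteq> 0" for k using nzA[of "Suc k"] by (simp add: A_def)
  have dA: "d k = (-1) ^ k / (A k * A (Suc k))" for k by (simp add: d A_def)
  have "(\<lambda>k. (d k * c k) / (d (Suc k) * c k)) \<longlonglongrightarrow> L / L"
    by (intro tendsto_divide lim lim' L)
  then have "(\<lambda>k. - ((d k * c k) / (d (Suc k) * c k))) \<longlonglongrightarrow> - 1"
    using L by (intro tendsto_minus) simp
  moreover have "\<forall>\<^sub>F k in sequentially.
      - ((d k * c k) / (d (Suc k) * c k)) = A (Suc (Suc k)) / A k"
    using tendsto_imp_eventually_ne[OF lim' L] eventually_gt_at_top[of 0]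
  proof eventually_elim
    case (elim k)
    then have "A k \<noteq> 0" using nz[of "k - 1"] by simp
    then show ?case
      using elim nz[of k] nz[of "Suc k"] by (simp add: dA field_simps)
  qed
  ultimately have ratio: "(\<lambda>k. A (Suc (Suc k)) / A k) \<longlonglongrightarrow> - 1"
    by (rule Lim_transform_eventually)
  \<comment> \<open>For \<open>r = 0\<close> the sequence \<open>A\<close> is constant, and its ratios are \<open>1\<close> rather than \<open>-1\<close>.\<close>
  have r: "r > 0"
  proof (rule ccontr)
    assume "\<not> r > 0"
    then have "(\<lambda>k. A (Suc (Suc k)) / A k) = (\<lambda>k. 1)"
      using nz[of 0] by (simp add: A_def)
    with ratio have "(\<lambda>k. 1 :: complex) \<longlonglongrightarrow> -1" by simp
    then show False by (simp add: LIMSEQ_const_iff)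
  qed
  obtain \<alpha> \<beta> where sum: "\<alpha> + \<beta> = p" and prod: "\<alpha> * \<beta> = -1"
    using characteristic_roots .
  show False
  proof (cases "\<alpha> = \<beta>")
    case True
    have "L = 0"
      by (rule boundary_limit_zero_double_root[OF w u u0 u1 m r _ _ nzA, where \<alpha> = \<alpha> and s = s])
        (use sum prod True lim in \<open>simp_all add: c d\<close>)
    with L show False ..
  next
    case False
    have rec: "A (Suc (Suc k)) = (\<alpha> ^ r + \<beta> ^ r) * A (Suc k) - \<alpha> ^ r * \<beta> ^ r * A k" for k
      using subsampled_recurrence[OF w sum prod False, of "r * k + l" r]
      unfolding mult_2 by (simp add: A_def algebra_simps)
    have "(\<alpha> ^ r * \<beta> ^ r)\<^sup>2 = ((\<alpha> * \<beta>)\<^sup>2) ^ r"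
      by (simp add: power_mult_distrib power_mult[symmetric] mult.commute)
    then have "(\<alpha> ^ r * \<beta> ^ r)\<^sup>2 = 1" by (simp add: prod)
    note sq = alternating_ratio_roots_of_unity[OF rec this nz ratio]
    have "\<alpha> ^ (4 * r) = ((\<alpha> ^ r)\<^sup>2)\<^sup>2" "\<beta> ^ (4 * r) = ((\<beta> ^ r)\<^sup>2)\<^sup>2"
      by (simp_all flip: power_mult add: mult.commute)
    then have one: "\<alpha> ^ (4 * r) = 1" "\<beta> ^ (4 * r) = 1"
      by (simp_all add: sq)
    \<comment> \<open>The boundary term vanishes at all multiples of \<open>4 * r\<close>, which contradicts \<open>L \<noteq> 0\<close>.\<close>
    have "c (4 * r * j) = 0" for j
    proof -
      have "x ^ (m * (4 * r * j)) = (x ^ (4 * r)) ^ (m * j)" for x :: complex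
        by (simp flip: power_mult add: mult_ac)
      then have "(\<alpha> - \<beta>) * u (m * (4 * r * j)) = 0"
        unfolding binet[OF u sum prod] by (simp only: one u0) simp
      then have "u (m * (4 * r * j)) = 0" using False by simp
      then show ?thesis by (simp add: c)
    qed
    moreover have "strict_mono (\<lambda>j. 4 * r * j)"
      using r by (simp add: strict_mono_def)
    then have "(\<lambda>j. d (4 * r * j) * c (4 * r * j)) \<longlonglongrightarrow> L"
      using LIMSEQ_subseq_LIMSEQ[OF lim, of "\<lambda>j. 4 * r * j"] by (simp add: o_def)
    ultimately show False
      using L by (simp add: LIMSEQ_const_iff)
  qed
qed

section \<open>The reciprocal sums\<close>

theorem theorem7:
  fixes a b p :: complex
    and w u :: "nat \<Rightarrow> complex"
    and r s l m :: nat
  assumes w_0: "w 0 = a" and w_1: "w 1 = b"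
    and w_rec: "\<And>n. n \<ge> 2 \<Longrightarrow> w n = p * w (n - 1) + w (n - 2)"
    and u_0: "u 0 = 0" and u_1: "u 1 = 1"
    and u_rec: "\<And>n. n \<ge> 2 \<Longrightarrow> u n = p * u (n - 1) + u (n - 2)"
    and m_pos: "m > 0"
    and denom_factor: "u m * w (m + s) \<noteq> 0"
    and denom_lhs: "\<And>k. k \<ge> 1 \<Longrightarrow>
      w (r * k + l) * w (r * (k + 1) + l) * w (m * k + s) * w (m * (k + 1) + s) \<noteq> 0"
    and denom_rhs: "\<And>k. k \<ge> 1 \<Longrightarrow>
      w (r * k + l) * w (r * (k + 1) + l) * w (r * (k + 2) + l) * w (m * (k + 1) + s) \<noteq> 0"
  shows
    "(odd m \<and>
      summable_from_1 (\<lambda>k. 1 /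
        (w (r * k + l) * w (r * (k + 1) + l) * w (m * k + s) * w (m * (k + 1) + s))) \<and>
      summable_from_1 (\<lambda>k. (-1) ^ (k - 1) *
        (((w (r * k + l) + w (r * (k + 2) + l)) * u (m * k)) /
         (w (r * k + l) * w (r * (k + 1) + l) * w (r * (k + 2) + l) * w (m * (k + 1) + s))))
      \<longrightarrow>
      suminf_from_1 (\<lambda>k. 1 /
        (w (r * k + l) * w (r * (k + 1) + l) * w (m * k + s) * w (m * (k + 1) + s)))
      = 1 / (u m * w (m + s)) *
        suminf_from_1 (\<lambda>k. (-1) ^ (k - 1) *
        (((w (r * k + l) + w (r * (k + 2) + l)) * u (m * k)) /
         (w (r * k + l) * w (r * (k + 1) + l) * w (r * (k + 2) + l) * w (m * (k + 1) + s)))))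
     \<and>
     (even m \<and>
      summable_from_1 (\<lambda>k. (-1) ^ k /
        (w (r * k + l) * w (r * (k + 1) + l) * w (m * k + s) * w (m * (k + 1) + s))) \<and>
      summable_from_1 (\<lambda>k. (-1) ^ k *
        (((w (r * k + l) + w (r * (k + 2) + l)) * u (m * k)) /
         (w (r * k + l) * w (r * (k + 1) + l) * w (r * (k + 2) + l) * w (m * (k + 1) + s))))
      \<longrightarrow>
      suminf_from_1 (\<lambda>k. (-1) ^ k /
        (w (r * k + l) * w (r * (k + 1) + l) * w (m * k + s) * w (m * (k + 1) + s)))
      = 1 / (u m * w (m + s)) *
        suminf_from_1 (\<lambda>k. (-1) ^ k *
        (((w (r * k + l) + w (r * (k + 2) + l)) * u (m * k)) /
         (w (r * k + l) * w (r * (k + 1) + l) * w (r * (k + 2) + l) * w (m * (k + 1) + s)))))"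
proof -
  have w: "fib_like p w" unfolding fib_like_def using w_rec by simp
  have u: "fib_like p u" unfolding fib_like_def using u_rec by simp
  define A where "A k = w (r * k + l)" for k
  define B where "B k = w (m * k + s)" for k
  define D where "D = u m * w (m + s)"
  define d where "d k = (-1) ^ k / (A k * A (Suc k))" for k
  define c where "c k = u (m * k) / B (Suc k)" for k
  have nzA: "A (Suc k) \<noteq> 0" and nzB: "B (Suc k) \<noteq> 0" for k
    using denom_lhs[of "Suc k"] by (auto simp: A_def B_def)
  have D: "D \<noteq> 0" using denom_factor by (simp add: D_def)
  have cdiff: "c (Suc k) - c k = (-1) ^ (m * k) * D / (B (Suc k) * B (Suc (Suc k)))" for k
  proof -
    have "u (m * Suc k) * B (Suc k) - u (m * k) * B (Suc (Suc k)) = (-1) ^ (m * k) * D"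
      using fib_like_cross_difference[OF w u u_0 u_1, of "m * k" m "m + s"]
      by (simp add: B_def D_def algebra_simps)
    then show ?thesis
      using nzB[of k] nzB[of "Suc k"] by (simp add: c_def divide_simps mult_ac)
  qed
  have ddiff: "(d (Suc k) - d (Suc (Suc k))) * c (Suc k) =
      (-1) ^ Suc k * (((A (Suc k) + A (Suc (Suc (Suc k)))) * u (m * Suc k)) /
        (A (Suc k) * A (Suc (Suc k)) * A (Suc (Suc (Suc k))) * B (Suc (Suc k))))" for k
    using nzA[of k] nzA[of "Suc k"] nzA[of "Suc (Suc k)"] nzB[of "Suc k"]
    by (simp add: d_def c_def field_simps)
  have transfer: "suminf (\<lambda>k. d (Suc k) * (c (Suc k) - c k))
      = suminf (\<lambda>k. (d (Suc k) - d (Suc (Suc k))) * c (Suc k))"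
    if F: "summable (\<lambda>k. d (Suc k) * (c (Suc k) - c k))"
      and G: "summable (\<lambda>k. (d (Suc k) - d (Suc (Suc k))) * c (Suc k))"
  proof -
    have "c 0 = 0" by (simp add: c_def u_0)
    from summation_by_parts_limit[OF this F G] obtain L where L:
      "(\<Sum>k. d (Suc k) * (c (Suc k) - c k))
         = (\<Sum>k. (d (Suc k) - d (Suc (Suc k))) * c (Suc k)) + L"
      "(\<lambda>n. d (Suc n) * c n) \<longlonglongrightarrow> L" "(\<lambda>n. d n * c n) \<longlonglongrightarrow> L" .
    have nz: "w (r * k + l) \<noteq> 0" if "k \<ge> 1" for k
      using denom_lhs[OF that] by simp
    have "L = 0"
      by (rule boundary_limit_zero[OF w u u_0 u_1 m_pos nz _ _ L(3) L(2), where s = s])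
        (simp_all add: d_def c_def A_def B_def)
    with L show ?thesis by simp
  qed
  \<comment> \<open>For both parities the two sides are those of \<open>transfer\<close>, up to the factor \<open>D\<close> and a common sign \<open>\<sigma>\<close>:
      \<open>-1\<close> for odd \<open>m\<close> and \<open>1\<close> for even \<open>m\<close>.\<close>
  have signed: "suminf f = 1 / D * suminf g"
    if f: "\<And>k. d (Suc k) * (c (Suc k) - c k) = \<sigma> * D * f k"
      and g: "\<And>k. (d (Suc k) - d (Suc (Suc k))) * c (Suc k) = \<sigma> * g k"
      and sf: "summable f" and sg: "summable g" and \<sigma>: "\<sigma> \<noteq> 0"
    for f g and \<sigma> :: complex
  proof -
    have "\<sigma> * D * suminf f = \<sigma> * suminf g"
      using transfer unfolding f g
      by (simp add: summable_mult sf sg suminf_mult)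
    then show ?thesis using \<sigma> D by (simp add: field_simps)
  qed
  have A': "w (r * Suc k + l) = A (Suc k)" "w (r * (Suc k + 1) + l) = A (Suc (Suc k))"
     "w (r * (Suc k + 2) + l) = A (Suc (Suc (Suc k)))" for k
    by (simp_all add: A_def)
  have B': "w (m * Suc k + s) = B (Suc k)" "w (m * (Suc k + 1) + s) = B (Suc (Suc k))" for k
    by (simp_all add: B_def)
  show ?thesis
    unfolding A' B' D_def[symmetric]
  proof (intro conjI impI; elim conjE)
    assume m: "odd m"
      and sf: "summable (\<lambda>k. 1 / (A (Suc k) * A (Suc (Suc k)) * B (Suc k) * B (Suc (Suc k))))"
      and sg: "summable (\<lambda>k. (-1) ^ (Suc k - 1) *
        (((A (Suc k) + A (Suc (Suc (Suc k)))) * u (m * Suc k)) /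
         (A (Suc k) * A (Suc (Suc k)) * A (Suc (Suc (Suc k))) * B (Suc (Suc k)))))"
    have "(-1::complex) ^ (m * k) = (-1) ^ k" for k using m by (simp add: power_mult)
    then have "d (Suc k) * (c (Suc k) - c k)
        = - 1 * D * (1 / (A (Suc k) * A (Suc (Suc k)) * B (Suc k) * B (Suc (Suc k))))" for k
      unfolding cdiff d_def by (simp add: mult_ac flip: power_mult_distrib)
    then show "(\<Sum>k. 1 / (A (Suc k) * A (Suc (Suc k)) * B (Suc k) * B (Suc (Suc k)))) =
      1 / D * (\<Sum>k. (-1) ^ (Suc k - 1) *
        (((A (Suc k) + A (Suc (Suc (Suc k)))) * u (m * Suc k)) /
         (A (Suc k) * A (Suc (Suc k)) * A (Suc (Suc (Suc k))) * B (Suc (Suc k)))))"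
      by (rule signed[OF _ _ sf sg]) (simp_all add: ddiff)
  next
    assume m: "even m"
      and sf: "summable (\<lambda>k. (-1) ^ Suc k / (A (Suc k) * A (Suc (Suc k)) * B (Suc k) * B (Suc (Suc k))))"
      and sg: "summable (\<lambda>k. (-1) ^ Suc k *
        (((A (Suc k) + A (Suc (Suc (Suc k)))) * u (m * Suc k)) /
         (A (Suc k) * A (Suc (Suc k)) * A (Suc (Suc (Suc k))) * B (Suc (Suc k)))))"
    have "d (Suc k) * (c (Suc k) - c k) = 1 * D *
        ((-1) ^ Suc k / (A (Suc k) * A (Suc (Suc k)) * B (Suc k) * B (Suc (Suc k))))" for k
      unfolding cdiff d_def using m by (simp add: mult_ac)
    then show "(\<Sum>k. (-1) ^ Suc k / (A (Suc k) * A (Suc (Suc k)) * B (Suc k) * B (Suc (Suc k)))) =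
      1 / D * (\<Sum>k. (-1) ^ Suc k *
        (((A (Suc k) + A (Suc (Suc (Suc k)))) * u (m * Suc k)) /
         (A (Suc k) * A (Suc (Suc k)) * A (Suc (Suc (Suc k))) * B (Suc (Suc k)))))"
      by (rule signed[OF _ _ sf sg]) (simp_all add: ddiff)
  qed
qed

end
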